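(* Assume that $\varphi$ is non-contractive, and let $(S,\iota)$ be a free analytic 1-submanifold of $M$ with $S\cong U(1)$ and $S\notin\mathcal F(S)$. Let $\Sigma\in\mathcal M(S)$ with $\Sigma\subset S$, and let $\Sigma_0,\dots,\Sigma_n$, $[g_0],\dots,[g_n]$ be a $\Sigma$-decomposition of $S$. Then for each $\Sigma'\in\mathrm{Seg}(S)$ and $g\in G$ with $g\cdot\iota(\Sigma_0)=\iota(\Sigma')$, there is a unique $k\in\{0,\dots,n\}$ such that $[g]=[g_k]$ and $\Sigma'=\Sigma_k$. In particular: a) If $n=1$, then there exists no other $\Sigma$-decomposition of $S$. b) If $n\ge2$, then the only other $\Sigma$-decomposition of $S$ is given by $\overline\Sigma_0=\Sigma$, $[\overline g_0]=[g_0]$ and $\overline\Sigma_k:=\Sigma_{\zeta(k)}$, $[\overline g_k]:=[g_{\zeta(k)}]$ for $k=1,\dots,n$, with $\zeta(k):=n-(k-1)$ for $k=1,\dots,n$.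
   Context: Manifolds and Lie groups are finite-dimensional, Hausdorff, real analytic, without boundary unless stated otherwise, and not assumed second countable. $\varphi\colon G\times M\to M$, $(g,x)\mapsto g\cdot x$, is a left action of a Lie group $G$ on an analytic manifold $M$ such that $g\mapsto g\cdot x$ is continuous for each $x\in M$. $\varphi$ is analytic in $M$ if $x\mapsto g\cdot x$ is analytic for each $g\in G$; it is non-contractive if it is analytic in $M$ and for each $C\subseteq M$ with $|C|\ge 2$ and each $x\in M\setminus C$ there is a neighbourhood $U$ of $x$ with $g\cdot C\not\subseteq U$ for all $g\in G$. An analytic 1-submanifold $(S,\iota)$ of $M$ consists of a connected, Hausdorff, second countable 1-dimensional analytic manifold $S$ with (possibly empty) boundary and an injective analytic immersion $\iota\colon S\to M$. $S\cong U(1)$ means that $S$ is homeomorphic to $U(1)$. A segment is a connected subset of $S$ with more than one point; $\mathrm{Seg}(S)$ is the set of segments. For $\Sigma\in\mathrm{Seg}(S)$ (with $S\cong U(1)$), $\mathrm{int}[\Sigma]$ is the topological interior of $\Sigma$ in $S$ and $\partial_\Sigma:=\Sigma\setminus\mathrm{int}[\Sigma]$. The symbol $\subset$ means proper inclusion. $g\cdot\iota$ denotes $z\mapsto g\cdot\iota(z)$; $G_S:=\bigcap_{z\in S}G_{\iota(z)}$ (intersection of stabilizers), $\mathcal H(S):=G/G_S$ (left cosets), and $[g]\in\mathcal H(S)$ is the class of $g$. For $\Sigma,\Sigma'\in\mathrm{Seg}(S)$ and $g\in G$, write $g\cdot\iota|_\Sigma\sim_\circ\iota|_{\Sigma'}$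 if $g\cdot\iota(O)=\iota(O')$ for open (in $S$) segments $O\subseteq\Sigma$, $O'\subseteq\Sigma'$ on which $\iota$ is an embedding. $\Sigma\in\mathrm{Seg}(S)$ is a free segment, $\Sigma\in\mathcal F(S)$, if for $g\in G$: $g\cdot\iota|_\Sigma\sim_\circ\iota|_\Sigma\Leftrightarrow g\in G_S$. $\mathcal M(S)$ is the set of inclusion-maximal elements of $\mathcal F(S)$. $(S,\iota)$ is free if $\mathcal F(S)\neq\emptyset$. $\Sigma$-decomposition ($S\cong U(1)$). For $\Sigma\in\mathcal M(S)$, $\Sigma\subset S$: a $\Sigma$-decomposition of $S$ consists of (compact) $\Sigma_0,\dots,\Sigma_n\in\mathcal M(S)$, $n\ge1$, and classes $[g_0],\dots,[g_n]\in\mathcal H(S)$ with $\Sigma_0=\Sigma$, $S=\bigcup_{k=0}^n\Sigma_k$, $g_k\cdot\iota(\Sigma_0)=\iota(\Sigma_k)$ for $0\le k\le n$; if $n=1$, $\Sigma_0\cap\Sigma_1=\partial_{\Sigma_0}\cap\partial_{\Sigma_1}$ consists of the two boundary points of $\Sigma_0$ and $\Sigma_1$; if $n\ge2$, $\Sigma_p\cap\Sigma_q=\partial_{\Sigma_p}\cap\partial_{\Sigma_q}$ is a singleton for $|p-q|\in\{1,n\}$ and empty for $2\le|p-q|\le n-1$. *)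

theory Defs
  imports "HOL-Analysis.Analysis" "HOL-Algebra.Group_Action" "HOL-Algebra.Left_Coset"
begin

section \<open>Real analytic functions\<close>

text \<open>
  Points of $n$-dimensional space are functions from \<open>nat\<close> to \<open>real\<close> that vanish from index
  \<open>n\<close> on, as in \<^const>\<open>Euclidean_space\<close>; the dimension 0 is allowed, so that discrete
  groups count as Lie groups.

  \<open>f\<close> is analytic on \<open>V\<close> if near each point of \<open>V\<close> it is the sum on \<open>V\<close> of a convergent power
  series, indexed by the multi-indices \<open>\<alpha>\<close>. The set \<open>V\<close> will be open in the whole space or in a
  half-space; in the latter case the condition at a boundary point says that \<open>f\<close> extends
  analytically to a full neighbourhood of it.
\<close>

definition real_analytic_on :: "nat \<Rightarrow> (nat \<Rightarrow> real) set \<Rightarrow> ((nat \<Rightarrow> real) \<Rightarrow> real) \<Rightarrow> bool" where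
  "real_analytic_on n V f \<longleftrightarrow>
     (\<forall>a\<in>V. \<exists>r>0. \<exists>c :: (nat \<Rightarrow> nat) \<Rightarrow> real. \<forall>x\<in>V. (\<forall>i<n. \<bar>x i - a i\<bar> < r) \<longrightarrow>
        ((\<lambda>\<alpha>. c \<alpha> * (\<Prod>i<n. (x i - a i) ^ \<alpha> i)) has_sum f x) {\<alpha>. \<forall>i\<ge>n. \<alpha> i = 0})"


section \<open>Analytic manifolds\<close>

type_synonym 'a chart = "'a set \<times> ('a \<Rightarrow> nat \<Rightarrow> real)"

record 'a manifold =
  man_top :: "'a topology"
  man_dim :: nat
  man_charts :: "'a chart set"

abbreviation points :: "'a manifold \<Rightarrow> 'a set" where
  "points X \<equiv> topspace (man_top X)"

text \<open>The flag \<open>b\<close> says whether charts with values in a half-space are admitted.\<close>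

definition model_spaces :: "bool \<Rightarrow> (nat \<Rightarrow> real) set set" where
  "model_spaces b = (if b then {UNIV, {x. 0 \<le> x 0}} else {UNIV})"

definition is_chart :: "bool \<Rightarrow> 'a topology \<Rightarrow> nat \<Rightarrow> 'a chart \<Rightarrow> bool" where
  "is_chart b X n = (\<lambda>(U, \<psi>). openin X U \<and>
     (\<exists>H\<in>model_spaces b. openin (subtopology (Euclidean_space n) H) (\<psi> ` U)) \<and>
     homeomorphic_map (subtopology X U) (subtopology (Euclidean_space n) (\<psi> ` U)) \<psi>)"

text \<open>
  The local representative of \<open>f\<close> in the charts \<open>(U, \<psi>)\<close> and \<open>(V, \<theta>)\<close>, and its domain.
\<close>

definition local_dom :: "('a \<Rightarrow> 'b) \<Rightarrow> 'a chart \<Rightarrow> 'b chart \<Rightarrow> (nat \<Rightarrow> real) set" where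
  "local_dom f = (\<lambda>(U, \<psi>) (V, \<theta>). \<psi> ` {x \<in> U. f x \<in> V})"

definition local_rep :: "('a \<Rightarrow> 'b) \<Rightarrow> 'a chart \<Rightarrow> 'b chart \<Rightarrow> (nat \<Rightarrow> real) \<Rightarrow> nat \<Rightarrow> real" where
  "local_rep f = (\<lambda>(U, \<psi>) (V, \<theta>) y. \<theta> (f (inv_into U \<psi> y)))"

definition analytic_in_charts :: "nat \<Rightarrow> nat \<Rightarrow> ('a \<Rightarrow> 'b) \<Rightarrow> 'a chart \<Rightarrow> 'b chart \<Rightarrow> bool" where
  "analytic_in_charts n m f c d \<longleftrightarrow>
     (\<forall>i<m. real_analytic_on n (local_dom f c d) (\<lambda>y. local_rep f c d y i))"

definition analytic_manifold_gen :: "bool \<Rightarrow> 'a manifold \<Rightarrow> bool" where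
  "analytic_manifold_gen b X \<longleftrightarrow>
     Hausdorff_space (man_top X) \<and>
     (\<forall>c\<in>man_charts X. is_chart b (man_top X) (man_dim X) c) \<and>
     (\<Union>c\<in>man_charts X. fst c) = points X \<and>
     (\<forall>c\<in>man_charts X. \<forall>d\<in>man_charts X. analytic_in_charts (man_dim X) (man_dim X) (\<lambda>x. x) c d)"

abbreviation analytic_manifold :: "'a manifold \<Rightarrow> bool" where
  "analytic_manifold \<equiv> analytic_manifold_gen False"

abbreviation analytic_manifold_with_boundary :: "'a manifold \<Rightarrow> bool" where
  "analytic_manifold_with_boundary \<equiv> analytic_manifold_gen True"

definition analytic_map :: "'a manifold \<Rightarrow> 'b manifold \<Rightarrow> ('a \<Rightarrow> 'b) \<Rightarrow> bool" where
  "analytic_map X Y f \<longleftrightarrow>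
     continuous_map (man_top X) (man_top Y) f \<and>
     (\<forall>c\<in>man_charts X. \<forall>d\<in>man_charts Y. analytic_in_charts (man_dim X) (man_dim Y) f c d)"

text \<open>Product of manifolds without boundary: coordinates are concatenated.\<close>

definition prod_chart :: "nat \<Rightarrow> 'a chart \<Rightarrow> 'b chart \<Rightarrow> ('a \<times> 'b) chart" where
  "prod_chart n = (\<lambda>(U, \<psi>) (V, \<theta>).
     (U \<times> V, \<lambda>(x, y) i. if i < n then \<psi> x i else \<theta> y (i - n)))"

definition prod_manifold :: "'a manifold \<Rightarrow> 'b manifold \<Rightarrow> ('a \<times> 'b) manifold" where
  "prod_manifold X Y =
     \<lparr>man_top = prod_topology (man_top X) (man_top Y),
      man_dim = man_dim X + man_dim Y,
      man_charts = {prod_chart (man_dim X) c d | c d. c \<in> man_charts X \<and> d \<in> man_charts Y}\<rparr>"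


section \<open>Lie groups and their actions\<close>

definition lie_group :: "('g, 'r) monoid_scheme \<Rightarrow> 'g manifold \<Rightarrow> bool" where
  "lie_group G L \<longleftrightarrow>
     group G \<and> analytic_manifold L \<and> points L = carrier G \<and>
     analytic_map (prod_manifold L L) L (\<lambda>(g, h). g \<otimes>\<^bsub>G\<^esub> h) \<and>
     analytic_map L L (\<lambda>g. inv\<^bsub>G\<^esub> g)"

definition pointwise_continuous_action ::
  "('g, 'r) monoid_scheme \<Rightarrow> 'g manifold \<Rightarrow> 'm manifold \<Rightarrow> ('g \<Rightarrow> 'm \<Rightarrow> 'm) \<Rightarrow> bool" where
  "pointwise_continuous_action G L M \<phi> \<longleftrightarrow>
     group_action G (points M) \<phi> \<and>
     (\<forall>x\<in>points M. continuous_map (man_top L) (man_top M) (\<lambda>g. \<phi> g x))"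

definition action_analytic_in ::
  "('g, 'r) monoid_scheme \<Rightarrow> 'm manifold \<Rightarrow> ('g \<Rightarrow> 'm \<Rightarrow> 'm) \<Rightarrow> bool" where
  "action_analytic_in G M \<phi> \<longleftrightarrow> (\<forall>g\<in>carrier G. analytic_map M M (\<phi> g))"

text \<open>
  The sets \<open>C\<close> may be infinite, so ``at least two elements'' is not expressed with \<^const>\<open>card\<close>.
\<close>

definition non_contractive ::
  "('g, 'r) monoid_scheme \<Rightarrow> 'm manifold \<Rightarrow> ('g \<Rightarrow> 'm \<Rightarrow> 'm) \<Rightarrow> bool" where
  "non_contractive G M \<phi> \<longleftrightarrow>
     action_analytic_in G M \<phi> \<and>
     (\<forall>C \<subseteq> points M. (\<exists>a\<in>C. \<exists>b\<in>C. a \<noteq> b) \<longrightarrow>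
        (\<forall>x \<in> points M - C. \<exists>U. openin (man_top M) U \<and> x \<in> U \<and>
           (\<forall>g\<in>carrier G. \<not> \<phi> g ` C \<subseteq> U)))"


section \<open>Analytic 1-submanifolds\<close>

definition line_point :: "real \<Rightarrow> nat \<Rightarrow> real" where
  "line_point t = (\<lambda>i. if i = 0 then t else 0)"

text \<open>
  For a 1-dimensional source the differential is injective iff it is nonzero, that is, iff some
  coordinate of the local representative has nonzero derivative; the derivative is one-sided at
  a boundary point.
\<close>

definition immersion_1d :: "'s manifold \<Rightarrow> 'm manifold \<Rightarrow> ('s \<Rightarrow> 'm) \<Rightarrow> bool" where
  "immersion_1d S M \<iota> \<longleftrightarrow>
     (\<forall>c\<in>man_charts S. \<forall>d\<in>man_charts M. \<forall>z. z \<in> fst c \<and> \<iota> z \<in> fst d \<longrightarrow>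
        (\<exists>i<man_dim M. \<exists>D. D \<noteq> 0 \<and>
           ((\<lambda>t. local_rep \<iota> c d (line_point t) i) has_real_derivative D)
             (at (snd c z 0) within {t. line_point t \<in> local_dom \<iota> c d})))"

definition analytic_1_submanifold :: "'m manifold \<Rightarrow> 's manifold \<Rightarrow> ('s \<Rightarrow> 'm) \<Rightarrow> bool" where
  "analytic_1_submanifold M S \<iota> \<longleftrightarrow>
     analytic_manifold_with_boundary S \<and> man_dim S = 1 \<and>
     connected_space (man_top S) \<and> second_countable (man_top S) \<and>
     analytic_map S M \<iota> \<and> inj_on \<iota> (points S) \<and> immersion_1d S M \<iota>"

text \<open>The unitary group U(1), as a topological space, is the unit circle in the complex plane.\<close>

definition homeomorphic_U1 :: "'s manifold \<Rightarrow> bool" where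
  "homeomorphic_U1 S \<longleftrightarrow> man_top S homeomorphic_space top_of_set (sphere (0::complex) 1)"

definition segments :: "'s manifold \<Rightarrow> 's set set" where
  "segments S = {\<Sigma>. connectedin (man_top S) \<Sigma> \<and> (\<exists>a\<in>\<Sigma>. \<exists>b\<in>\<Sigma>. a \<noteq> b)}"

definition seg_boundary :: "'s manifold \<Rightarrow> 's set \<Rightarrow> 's set" where
  "seg_boundary S \<Sigma> = \<Sigma> - (man_top S) interior_of \<Sigma>"


section \<open>Free segments\<close>

definition pointwise_stabilizer ::
  "('g, 'r) monoid_scheme \<Rightarrow> ('g \<Rightarrow> 'm \<Rightarrow> 'm) \<Rightarrow> 's manifold \<Rightarrow> ('s \<Rightarrow> 'm) \<Rightarrow> 'g set" where
  "pointwise_stabilizer G \<phi> S \<iota> = (\<Inter>z\<in>points S. stabilizer G \<phi> (\<iota> z))"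

definition sim_open ::
  "('g \<Rightarrow> 'm \<Rightarrow> 'm) \<Rightarrow> 'm manifold \<Rightarrow> 's manifold \<Rightarrow> ('s \<Rightarrow> 'm) \<Rightarrow> 'g \<Rightarrow> 's set \<Rightarrow> 's set \<Rightarrow> bool"
where
  "sim_open \<phi> M S \<iota> g \<Sigma> \<Sigma>' \<longleftrightarrow>
     (\<exists>A B. A \<in> segments S \<and> B \<in> segments S \<and> openin (man_top S) A \<and> openin (man_top S) B \<and>
        A \<subseteq> \<Sigma> \<and> B \<subseteq> \<Sigma>' \<and>
        embedding_map (subtopology (man_top S) A) (man_top M) \<iota> \<and>
        embedding_map (subtopology (man_top S) B) (man_top M) \<iota> \<and>
        \<phi> g ` \<iota> ` A = \<iota> ` B)"

definition free_segments ::
  "('g, 'r) monoid_scheme \<Rightarrow> ('g \<Rightarrow> 'm \<Rightarrow> 'm) \<Rightarrow> 'm manifold \<Rightarrow> 's manifold \<Rightarrow> ('s \<Rightarrow> 'm) \<Rightarrow> 's set set"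
where
  "free_segments G \<phi> M S \<iota> =
     {\<Sigma> \<in> segments S. \<forall>g\<in>carrier G.
        sim_open \<phi> M S \<iota> g \<Sigma> \<Sigma> \<longleftrightarrow> g \<in> pointwise_stabilizer G \<phi> S \<iota>}"

definition maximal_free_segments ::
  "('g, 'r) monoid_scheme \<Rightarrow> ('g \<Rightarrow> 'm \<Rightarrow> 'm) \<Rightarrow> 'm manifold \<Rightarrow> 's manifold \<Rightarrow> ('s \<Rightarrow> 'm) \<Rightarrow> 's set set"
where
  "maximal_free_segments G \<phi> M S \<iota> =
     {\<Sigma> \<in> free_segments G \<phi> M S \<iota>. \<forall>\<Sigma>' \<in> free_segments G \<phi> M S \<iota>. \<Sigma> \<subseteq> \<Sigma>' \<longrightarrow> \<Sigma>' = \<Sigma>}"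

definition free_submanifold ::
  "('g, 'r) monoid_scheme \<Rightarrow> ('g \<Rightarrow> 'm \<Rightarrow> 'm) \<Rightarrow> 'm manifold \<Rightarrow> 's manifold \<Rightarrow> ('s \<Rightarrow> 'm) \<Rightarrow> bool" where
  "free_submanifold G \<phi> M S \<iota> \<longleftrightarrow> free_segments G \<phi> M S \<iota> \<noteq> {}"


section \<open>Decompositions\<close>

definition coset_of ::
  "('g, 'r) monoid_scheme \<Rightarrow> ('g \<Rightarrow> 'm \<Rightarrow> 'm) \<Rightarrow> 's manifold \<Rightarrow> ('s \<Rightarrow> 'm) \<Rightarrow> 'g \<Rightarrow> 'g set" where
  "coset_of G \<phi> S \<iota> g = g <#\<^bsub>G\<^esub> pointwise_stabilizer G \<phi> S \<iota>"

text \<open>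
  A decomposition is given by \<open>n\<close>, the segments \<open>\<Sigma>s 0, \<dots>, \<Sigma>s n\<close>, and the cosets
  \<open>cs 0, \<dots>, cs n\<close>; the values of \<open>\<Sigma>s\<close> and \<open>cs\<close> beyond \<open>n\<close> are irrelevant. All elements of a
  coset act in the same way on the image of \<open>\<iota>\<close>.
\<close>

definition sigma_decomposition ::
  "('g, 'r) monoid_scheme \<Rightarrow> ('g \<Rightarrow> 'm \<Rightarrow> 'm) \<Rightarrow> 'm manifold \<Rightarrow> 's manifold \<Rightarrow> ('s \<Rightarrow> 'm) \<Rightarrow>
   's set \<Rightarrow> nat \<Rightarrow> (nat \<Rightarrow> 's set) \<Rightarrow> (nat \<Rightarrow> 'g set) \<Rightarrow> bool"
where
  "sigma_decomposition G \<phi> M S \<iota> \<Sigma> n \<Sigma>s cs \<longleftrightarrow>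
     1 \<le> n \<and>
     (\<forall>k\<le>n. \<Sigma>s k \<in> maximal_free_segments G \<phi> M S \<iota> \<and> compactin (man_top S) (\<Sigma>s k)) \<and>
     (\<forall>k\<le>n. cs k \<in> lcosets\<^bsub>G\<^esub> (pointwise_stabilizer G \<phi> S \<iota>)) \<and>
     \<Sigma>s 0 = \<Sigma> \<and>
     points S = (\<Union>k\<le>n. \<Sigma>s k) \<and>
     (\<forall>k\<le>n. \<forall>g\<in>cs k. \<phi> g ` \<iota> ` \<Sigma>s 0 = \<iota> ` \<Sigma>s k) \<and>
     (n = 1 \<longrightarrow>
        \<Sigma>s 0 \<inter> \<Sigma>s 1 = seg_boundary S (\<Sigma>s 0) \<inter> seg_boundary S (\<Sigma>s 1) \<and>
        seg_boundary S (\<Sigma>s 0) = seg_boundary S (\<Sigma>s 1) \<and>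
        card (seg_boundary S (\<Sigma>s 0)) = 2) \<and>
     (2 \<le> n \<longrightarrow>
        (\<forall>p\<le>n. \<forall>q\<le>n.
           (\<bar>int p - int q\<bar> \<in> {1, int n} \<longrightarrow>
              \<Sigma>s p \<inter> \<Sigma>s q = seg_boundary S (\<Sigma>s p) \<inter> seg_boundary S (\<Sigma>s q) \<and>
              is_singleton (\<Sigma>s p \<inter> \<Sigma>s q)) \<and>
           (2 \<le> \<bar>int p - int q\<bar> \<and> \<bar>int p - int q\<bar> \<le> int n - 1 \<longrightarrow> \<Sigma>s p \<inter> \<Sigma>s q = {})))"

definition same_family ::
  "nat \<Rightarrow> (nat \<Rightarrow> 's set) \<Rightarrow> (nat \<Rightarrow> 'g set) \<Rightarrow> nat \<Rightarrow> (nat \<Rightarrow> 's set) \<Rightarrow> (nat \<Rightarrow> 'g set) \<Rightarrow> bool" where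
  "same_family n \<Sigma>s cs n' \<Sigma>s' cs' \<longleftrightarrow> n' = n \<and> (\<forall>k\<le>n. \<Sigma>s' k = \<Sigma>s k \<and> cs' k = cs k)"

definition zeta :: "nat \<Rightarrow> nat \<Rightarrow> nat" where
  "zeta n k = n - (k - 1)"

text \<open>Index 0 is kept and the indices \<open>1, \<dots>, n\<close> are reversed.\<close>

definition reversed :: "nat \<Rightarrow> (nat \<Rightarrow> 'x) \<Rightarrow> nat \<Rightarrow> 'x" where
  "reversed n f = (\<lambda>k. if k = 0 then f 0 else f (zeta n k))"

end

theory Submission
  imports Defs
begin

text \<open>
  A translate \<open>g \<cdot> \<iota>(\<Sigma>\<^sub>0) = \<iota>(\<Sigma>')\<close> overlaps some \<open>\<Sigma>\<^sub>k\<close> in a nonempty open segment, because the finitely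
  many closed segments \<open>\<Sigma>\<^sub>k\<close> cover the circle. Since \<open>\<iota>\<close> is an embedding, the overlap can be shrunk
  until its preimages in \<open>\<Sigma>\<^sub>0\<close> under \<open>g\<close> and \<open>g\<^sub>k\<close> are both open segments; then \<open>g\<^sub>k\<inverse>g\<close> maps one of them
  to the other, and freeness of \<open>\<Sigma>\<^sub>0\<close> puts it into \<open>G\<^sub>S\<close>. Hence two decompositions starting at the same
  segment differ by a permutation of the indices that fixes 0 and preserves adjacency in the cycle
  \<open>0, \<dots>, n\<close>, so that it is the identity or the reflection.
\<close>

section \<open>Segments and open sets of the circle\<close>

text \<open>If \<open>C\<close> misses a point \<open>p\<close>, stereographic projection from
  \<open>p\<close> identifies the punctured circle with the real line. There a connected set with
  two points contains the open interval between them. Pulling this interval back gives a set open in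
  the circle, because the punctured circle is itself open.\<close>

lemma circle_connected_contains_open:
  fixes C :: "complex set"
  assumes C: "connected C" "C \<subseteq> sphere 0 1" and ab: "a \<in> C" "b \<in> C" "a \<noteq> b"
  obtains A where "A \<subseteq> C" "connected A" "openin (top_of_set (sphere 0 1)) A"
    "\<exists>x\<in>A. \<exists>y\<in>A. x \<noteq> y"
proof (cases "C = sphere 0 1")
  case True
  have "\<exists>x\<in>C. \<exists>y\<in>C. x \<noteq> y" using ab by blast
  then show ?thesis by (intro that[of C]) (use True C in auto)
next
  case False
  then obtain p where p: "p \<in> sphere 0 1" "p \<notin> C" using C by blast
  have "(sphere (0::complex) 1 - {p}) homeomorphic (UNIV::real set)"
    by (rule homeomorphic_punctured_sphere_affine) (use p in auto)
  then obtain f g where fg: "homeomorphism (sphere (0::complex) 1 - {p}) (UNIV::real set) f g"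
    by (auto simp: homeomorphic_def)
  have sub: "C \<subseteq> sphere 0 1 - {p}" using C p by blast
  have gf: "g (f x) = x" if "x \<in> C" for x
    using that sub homeomorphism_apply1[OF fg] by blast
  have "connected (f ` C)"
    by (meson C(1) connected_continuous_image continuous_on_subset fg homeomorphism_def sub)
  have ne: "f a \<noteq> f b" using gf ab by metis
  define u v where "u = min (f a) (f b)" and "v = max (f a) (f b)"
  have uv: "u < v" "u \<in> f ` C" "v \<in> f ` C"
    using ne ab by (auto simp: u_def v_def min_def max_def)
  have int: "{u<..<v} \<subseteq> f ` C"
    using connected_contains_Icc[OF \<open>connected (f ` C)\<close> uv(2,3)] by (force simp: subset_iff)
  define A where "A = g ` {u<..<v}"
  have "A \<subseteq> C" using int gf by (force simp: A_def)
  moreover have "connected A" unfolding A_def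
    by (rule connected_continuous_image)
       (use fg in \<open>auto simp: homeomorphism_def intro: continuous_on_subset\<close>)
  moreover have "openin (top_of_set (sphere 0 1)) A"
  proof (rule openin_trans)
    show "openin (top_of_set (sphere 0 1 - {p})) A" unfolding A_def
      by (rule homeomorphism_imp_open_map[OF homeomorphism_symD[OF fg]]) auto
    show "openin (top_of_set (sphere 0 1)) (sphere 0 1 - {p})"
      by (rule openin_delete) simp
  qed
  moreover have "\<exists>x\<in>A. \<exists>y\<in>A. x \<noteq> y"
  proof -
    obtain s where s: "u < s" "s < v" using dense uv(1) by blast
    obtain t where t: "u < t" "t < s" using dense s(1) by blast
    have "g s \<noteq> g t" using t(2) homeomorphism_apply2[OF fg, of s] homeomorphism_apply2[OF fg, of t]
      by force
    then show ?thesis using s t unfolding A_def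
      by (intro bexI[of _ "g s"] bexI[of _ "g t"] imageI) auto
  qed
  ultimately show ?thesis using that by blast
qed

text \<open>The result for the unit circle carries over along a homeomorphism. It provides the open
  segments that \<open>sim_open\<close> asks for.\<close>

lemma segment_contains_open_segment:
  assumes U1: "homeomorphic_U1 S" and C: "C \<in> segments S"
  obtains A where "A \<subseteq> C" "A \<in> segments S" "openin (man_top S) A"
proof -
  obtain h k where hk: "homeomorphic_maps (man_top S) (top_of_set (sphere (0::complex) 1)) h k"
    using U1 by (auto simp: homeomorphic_U1_def homeomorphic_space_def)
  have hh: "homeomorphic_map (man_top S) (top_of_set (sphere (0::complex) 1)) h"
    and kk: "homeomorphic_map (top_of_set (sphere (0::complex) 1)) (man_top S) k"
    using hk by (auto simp: homeomorphic_maps_map)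
  have Csub: "C \<subseteq> points S" and Ccon: "connectedin (man_top S) C"
    using C by (auto simp: segments_def connectedin_def)
  have kh: "k (h x) = x" if "x \<in> points S" for x using hk that by (auto simp: homeomorphic_maps_def)
  have hk': "h (k x) = x" if "x \<in> sphere 0 1" for x using hk that by (auto simp: homeomorphic_maps_def)
  obtain a b where ab: "a \<in> C" "b \<in> C" "a \<noteq> b" using C by (auto simp: segments_def)
  have "connectedin (top_of_set (sphere (0::complex) 1)) (h ` C)"
    using homeomorphic_map_connectedness[OF hh Csub] Ccon by simp
  then have *: "connected (h ` C)" "h ` C \<subseteq> sphere 0 1"
    by (auto simp: connectedin_subtopology)
  have "h a \<noteq> h b" using kh ab Csub by (metis subsetD)
  then obtain A where A: "A \<subseteq> h ` C" "connected A" "openin (top_of_set (sphere 0 1)) A"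
    "\<exists>x\<in>A. \<exists>y\<in>A. x \<noteq> y"
    by (rule circle_connected_contains_open[OF * imageI[OF ab(1)] imageI[OF ab(2)]])
  have As: "A \<subseteq> sphere 0 1" using A * by blast
  show ?thesis
  proof
    show "k ` A \<subseteq> C" using A(1) kh Csub by force
    have "connectedin (man_top S) (k ` A)"
      using homeomorphic_map_connectedness[OF kk, of A] As A by (simp add: connectedin_subtopology)
    moreover have "\<exists>x\<in>k ` A. \<exists>y\<in>k ` A. x \<noteq> y" using A(4) As hk' by (metis image_eqI subsetD)
    ultimately show "k ` A \<in> segments S" by (simp add: segments_def)
    show "openin (man_top S) (k ` A)"
      using homeomorphic_map_openness[OF kk, of A] As A by simp
  qed
qed

text \<open>The angle parametrization \<open>k \<circ> cis\<close> pulls \<open>W\<close> back to an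
  open set of reals. A short closed interval in that set has a connected image inside
  \<open>W\<close>.\<close>

lemma open_contains_segment:
  assumes U1: "homeomorphic_U1 S" and W: "openin (man_top S) W" "W \<noteq> {}"
  obtains A where "A \<subseteq> W" "A \<in> segments S"
proof -
  obtain h k where hk: "homeomorphic_maps (man_top S) (top_of_set (sphere (0::complex) 1)) h k"
    using U1 by (auto simp: homeomorphic_U1_def homeomorphic_space_def)
  have kk: "continuous_map (top_of_set (sphere (0::complex) 1)) (man_top S) k"
    and kh: "\<And>x. x \<in> points S \<Longrightarrow> k (h x) = x"
    and hk': "\<And>z. z \<in> sphere 0 1 \<Longrightarrow> h (k z) = z"
    and hs: "\<And>x. x \<in> points S \<Longrightarrow> h x \<in> sphere 0 1"
    using hk by (auto simp: homeomorphic_maps_def continuous_map_def)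
  obtain x where x: "x \<in> W" "x \<in> points S" using W openin_subset by blast
  \<comment> \<open>On the unit circle \<open>sgn\<close> is the identity, so \<open>h x\<close> is
    recovered as \<open>cis\<close> of its argument.\<close>
  have "norm (h x) = 1" using hs[OF x(2)] by simp
  then have "cis (Arg (h x)) = h x" by (subst cis_Arg) (auto simp: sgn_div_norm)
  then obtain \<theta> where \<theta>: "h x = cis \<theta>" by metis
  have cis: "continuous_map euclideanreal (top_of_set (sphere (0::complex) 1)) cis"
    by (auto simp: continuous_map_in_subtopology intro!: continuous_intros continuous_on_cis)
  define c where "c = k \<circ> cis"
  have c: "continuous_map euclideanreal (man_top S) c"
    unfolding c_def using cis kk by (rule continuous_map_compose)
  have "open {t. c t \<in> W}"
    using openin_continuous_map_preimage[OF c W(1)] by simp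
  moreover have "\<theta> \<in> {t. c t \<in> W}" using x kh[OF x(2)] \<theta> by (simp add: c_def)
  ultimately obtain e where e: "e > 0" "cball \<theta> e \<subseteq> {t. c t \<in> W}"
    using open_contains_cball by blast
  \<comment> \<open>The cap at 1 keeps \<open>d\<close> below \<pi>. Hence \<open>sin d\<close> is
    positive and the two ends of the arc are different points.\<close>
  define d where "d = min e 1"
  have d: "0 < d" "d \<le> 1" "{\<theta>..\<theta>+d} \<subseteq> {t. c t \<in> W}"
    using e by (auto simp: d_def dist_real_def subset_iff)
  have "cis d \<noteq> 1"
  proof
    assume "cis d = 1"
    then have "sin d = 0" by (simp add: complex_eq_iff)
    then show False using sin_gt_zero[of d] d pi_gt3 by auto
  qed
  then have "cis (\<theta> + d) \<noteq> cis \<theta>" by (simp flip: cis_mult)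
  then have ne: "c (\<theta> + d) \<noteq> c \<theta>" unfolding c_def by (metis comp_apply hk' norm_cis dist_0_norm mem_sphere)
  show ?thesis
  proof
    show "c ` {\<theta>..\<theta>+d} \<subseteq> W" using d by blast
    have "connectedin (man_top S) (c ` {\<theta>..\<theta>+d})"
      by (rule connectedin_continuous_map_image[OF c]) auto
    moreover have "\<theta> \<in> {\<theta>..\<theta>+d}" "\<theta>+d \<in> {\<theta>..\<theta>+d}" using d by auto
    ultimately show "c ` {\<theta>..\<theta>+d} \<in> segments S" unfolding segments_def using ne by blast
  qed
qed

text \<open>A finite Baire argument: an open segment \<open>A\<close> inside \<open>C\<close> either
  lies in \<open>F i\<close>, or \<open>A - F i\<close> is open and nonempty and contains a segment
  covered by the remaining sets. The induction therefore has to run over all segments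
  \<open>C\<close>.\<close>

lemma segment_subset_finite_closed_union:
  assumes U1: "homeomorphic_U1 S" and "finite I"
    and "\<And>i. i \<in> I \<Longrightarrow> closedin (man_top S) (F i)"
    and "C \<in> segments S" "C \<subseteq> (\<Union>i\<in>I. F i)"
  shows "\<exists>i\<in>I. \<exists>A. A \<subseteq> C \<inter> F i \<and> A \<in> segments S \<and> openin (man_top S) A"
  using assms(2-)
proof (induction I arbitrary: C rule: finite_induct)
  case empty
  then show ?case by (auto simp: segments_def)
next
  case (insert i I)
  obtain A where A: "A \<subseteq> C" "A \<in> segments S" "openin (man_top S) A"
    using segment_contains_open_segment[OF U1 \<open>C \<in> segments S\<close>] by blast
  show ?case
  proof (cases "A \<subseteq> F i")
    case True
    with A show ?thesis by (intro bexI[of _ i] exI[of _ A]) auto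
  next
    case False
    have "openin (man_top S) (A - F i)"
      using A insert.prems(1)[of i] by (simp add: openin_diff)
    with False obtain B where B: "B \<subseteq> A - F i" "B \<in> segments S"
      by (metis Diff_eq_empty_iff open_contains_segment[OF U1])
    have "B \<subseteq> (\<Union>i\<in>I. F i)" using B A insert.prems(3) by auto
    then obtain j D where "j \<in> I" "D \<subseteq> B \<inter> F j" "D \<in> segments S" "openin (man_top S) D"
      using insert.IH[OF insert.prems(1) B(2)] by auto
    then show ?thesis using A B by (intro bexI[of _ j] exI[of _ D]) auto
  qed
qed

lemma embedding_open_segment:
  assumes U1: "homeomorphic_U1 S" and K: "K \<subseteq> points S"
    and f: "embedding_map (subtopology (man_top S) K) (man_top S) f"
    and C: "C \<in> segments S" "C \<subseteq> f ` K"
  obtains C' where "C' \<subseteq> C" "C' \<in> segments S" "openin (man_top S) C'"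
    "\<And>D. \<lbrakk>D \<subseteq> C'; D \<in> segments S; openin (man_top S) D\<rbrakk> \<Longrightarrow>
       {x \<in> K. f x \<in> D} \<in> segments S \<and> openin (man_top S) {x \<in> K. f x \<in> D}"
proof -
  let ?X = "subtopology (man_top S) K" and ?Y = "subtopology (man_top S) (f ` K)"
  have top: "topspace ?X = K" using K by auto
  have f: "homeomorphic_map ?X ?Y f" using f top by (simp add: embedding_map_def)
  have inj: "inj_on f K" using homeomorphic_imp_injective_map[OF f] top by simp
  have cont: "continuous_map ?X (man_top S) f"
    using homeomorphic_imp_continuous_map[OF f] by (auto simp: continuous_map_in_subtopology)
  define P where "P D = {x \<in> K. f x \<in> D}" for D
  have P_seg: "P D \<in> segments S" if D: "D \<in> segments S" "D \<subseteq> f ` K" for D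
  proof -
    have fP: "f ` P D = D" using D by (auto simp: P_def)
    have "connectedin ?Y D" using D by (simp add: connectedin_subtopology segments_def)
    then have "connectedin ?X (P D)"
      using homeomorphic_map_connectedness[OF f, of "P D"] fP top by (auto simp: P_def)
    then have "connectedin (man_top S) (P D)" by (simp add: connectedin_subtopology)
    moreover have "\<exists>a\<in>f ` P D. \<exists>b\<in>f ` P D. a \<noteq> b"
      unfolding fP using D by (simp add: segments_def)
    then have "\<exists>x\<in>P D. \<exists>y\<in>P D. x \<noteq> y" unfolding bex_simps(7) by metis
    ultimately show ?thesis by (simp add: segments_def)
  qed
  obtain A where A: "A \<subseteq> P C" "A \<in> segments S" "openin (man_top S) A"
    using segment_contains_open_segment[OF U1 P_seg[OF C]] by blast
  have AK: "A \<subseteq> K" using A by (auto simp: P_def)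
  have "connectedin (man_top S) (f ` A)"
    by (rule connectedin_continuous_map_image[OF cont])
       (use A AK in \<open>auto simp: connectedin_subtopology segments_def\<close>)
  moreover obtain a b where "a \<in> A" "b \<in> A" "a \<noteq> b" using A by (auto simp: segments_def)
  ultimately have "f ` A \<in> segments S"
    unfolding segments_def using inj_onD[OF inj] AK by blast
  then obtain C' where C': "C' \<subseteq> f ` A" "C' \<in> segments S" "openin (man_top S) C'"
    using segment_contains_open_segment[OF U1] by blast
  show ?thesis
  proof
    show "C' \<subseteq> C" using C' A by (auto simp: P_def)
    show "C' \<in> segments S" "openin (man_top S) C'" using C' by auto
    fix D assume D: "D \<subseteq> C'" "D \<in> segments S" "openin (man_top S) D"
    \<comment> \<open>Points of \<open>D\<close> have preimages in \<open>A\<close>, and by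
      injectivity these are their only preimages in \<open>K\<close>.\<close>
    have PA: "P D \<subseteq> A" using D C' AK inj by (auto simp: P_def inj_on_def subset_iff) blast
    have "openin ?X (P D)"
      using openin_continuous_map_preimage[OF cont D(3)] by (simp only: top P_def)
    then obtain U where U: "openin (man_top S) U" "P D = U \<inter> K" by (auto simp: openin_subtopology)
    \<comment> \<open>Replacing \<open>K\<close> by the open set \<open>A\<close> turns relative
      openness into openness in \<open>S\<close>.\<close>
    then have "P D = U \<inter> A" using PA AK by blast
    then have "openin (man_top S) (P D)" using U A by auto
    moreover have "P D \<in> segments S" using P_seg D C' AK by blast
    ultimately show "{x \<in> K. f x \<in> D} \<in> segments S \<and> openin (man_top S) {x \<in> K. f x \<in> D}"
      by (simp add: P_def)
  qed
qed

text \<open>A connected set with two points consists of limit points of itself, and a finite set has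
  none in a Hausdorff space. This separates segments that meet in finitely many points only.\<close>

lemma infinite_segment:
  assumes "Hausdorff_space (man_top S)" "C \<in> segments S"
  shows "infinite C"
proof
  assume fin: "finite C"
  obtain a b where ab: "a \<in> C" "b \<in> C" "a \<noteq> b" using assms by (auto simp: segments_def)
  then have "C \<subseteq> man_top S derived_set_of C"
    using assms by (intro connectedin_imp_perfect) (auto simp: segments_def)
  moreover have "man_top S derived_set_of C = {}"
    using Hausdorff_imp_t1_space[OF assms(1)] fin by (metis t1_space_derived_set_of_finite)
  ultimately show False using ab by blast
qed

section \<open>Translates of segments under the group\<close>

text \<open>Collects the topological facts on which the argument rests. Compactness of the circle
  then upgrades the continuous injection \<iota> to an embedding.\<close>

locale action_on_circle = group_action G "points M" \<phi>
  for G :: "('g, 'r) monoid_scheme" (structure) and M :: "'m manifold" and \<phi> +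
  fixes S :: "'s manifold" and \<iota> :: "'s \<Rightarrow> 'm"
  assumes cont: "g \<in> carrier G \<Longrightarrow> continuous_map (man_top M) (man_top M) (\<phi> g)"
    and Hausdorff_M: "Hausdorff_space (man_top M)"
    and circle: "homeomorphic_U1 S"
    and cont_iota: "continuous_map (man_top S) (man_top M) \<iota>"
    and inj_iota: "inj_on \<iota> (points S)"
begin

abbreviation H where "H \<equiv> pointwise_stabilizer G \<phi> S \<iota>"

lemma compact_S: "compact_space (man_top S)"
  using circle homeomorphic_compact_space[of "man_top S" "top_of_set (sphere (0::complex) 1)"]
  by (simp add: homeomorphic_U1_def compact_space_subtopology)

lemma Hausdorff_S: "Hausdorff_space (man_top S)"
  using circle homeomorphic_Hausdorff_space[of "man_top S" "top_of_set (sphere (0::complex) 1)"]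
  by (simp add: homeomorphic_U1_def Hausdorff_space_subtopology)

text \<open>Guards the intersection defining \<open>H\<close>: over an empty index set it would be
  the whole type instead of a subgroup.\<close>

lemma points_S_nonempty: "points S \<noteq> {}"
proof
  assume "points S = {}"
  then have "top_of_set (sphere (0::complex) 1) = trivial_topology"
    using circle homeomorphic_empty_space[of "man_top S" "top_of_set (sphere (0::complex) 1)"]
    by (simp add: homeomorphic_U1_def)
  then have "sphere (0::complex) 1 = {}"
    by (metis topspace_euclidean_subtopology topspace_discrete_topology)
  then show False by simp
qed

lemma iota_in: "z \<in> points S \<Longrightarrow> \<iota> z \<in> points M"
  using cont_iota by (auto simp: continuous_map_def)

lemma iota_image_eq: "A \<subseteq> points S \<Longrightarrow> B \<subseteq> points S \<Longrightarrow> \<iota> ` A = \<iota> ` B \<longleftrightarrow> A = B"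
  by (rule inj_on_image_eq_iff[OF inj_iota])

text \<open>A continuous map from a compact space to a Hausdorff space is closed. Restricted to
  subsets, this supplies the embedding conditions in \<open>sim_open\<close>.\<close>

lemma embedding_iota: "embedding_map (man_top S) (man_top M) \<iota>"
  by (intro injective_closed_imp_embedding_map continuous_imp_closed_map
      cont_iota compact_S Hausdorff_M inj_iota)

lemma embedding_iota_sub:
  assumes "A \<subseteq> points S" shows "embedding_map (subtopology (man_top S) A) (man_top M) \<iota>"
proof -
  have "embedding_map (subtopology (man_top S) A) (man_top S) id"
    using assms by (simp add: embedding_map_def topspace_subtopology_subset Int_absorb1)
  then show ?thesis using embedding_map_compose[OF _ embedding_iota] by fastforce
qed

lemma subgroup_H: "subgroup H G"
  unfolding pointwise_stabilizer_def
  by (intro group.subgroups_Inter[OF group_hom.axioms(1)[OF group_hom]])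
     (use points_S_nonempty stabilizer_subgroup iota_in in auto)

lemma group_G: "group G"
  using group_hom by (simp add: group_hom_def)

lemma act_inv:
  assumes "g \<in> carrier G" "x \<in> points M" shows "\<phi> (inv g) (\<phi> g x) = x"
  using orbit_sym_aux[OF assms] by simp

text \<open>Elements of \<open>H\<close> fix the image of \<iota> pointwise, so translates of that
  image depend only on the coset.\<close>

lemma act_coset_iota:
  assumes "g \<in> carrier G" "g' \<in> g <# H" "A \<subseteq> points S"
  shows "\<phi> g' ` \<iota> ` A = \<phi> g ` \<iota> ` A"
proof -
  obtain h where h: "h \<in> H" "g' = g \<otimes> h" using assms(2) by (auto simp: l_coset_def)
  have hG: "h \<in> carrier G" using h subgroup_H subgroup.subset by blast
  have "\<phi> g' (\<iota> z) = \<phi> g (\<iota> z)" if "z \<in> A" for z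
  proof -
    have "\<phi> h (\<iota> z) = \<iota> z" using h that assms(3) by (auto simp: pointwise_stabilizer_def stabilizer_def)
    then show ?thesis using composition_rule[OF _ assms(1) hG] iota_in that assms(3) h by force
  qed
  then show ?thesis by (simp add: image_image)
qed

text \<open>Pulls the action of \<open>g\<close> back to the circle: \<open>f\<close> is the inverse
  of \<iota> after \<open>\<phi> g\<close> after \<iota>. The assumption on images makes this well
  defined on \<open>K\<close>, and compactness of \<open>K\<close> makes it an embedding.\<close>

lemma transport_map:
  assumes g: "g \<in> carrier G" and K: "compactin (man_top S) K" and K': "K' \<subseteq> points S"
    and gK: "\<phi> g ` \<iota> ` K = \<iota> ` K'"
  obtains f where "embedding_map (subtopology (man_top S) K) (man_top S) f" "f ` K = K'"
    "\<And>x. x \<in> K \<Longrightarrow> \<iota> (f x) = \<phi> g (\<iota> x)"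
proof -
  have Ks: "K \<subseteq> points S" using K compactin_subset_topspace by blast
  obtain j where j: "homeomorphic_maps (man_top S) (subtopology (man_top M) (\<iota> ` points S)) \<iota> j"
    using embedding_iota by (auto simp: embedding_map_def homeomorphic_map_maps)
  have ji: "j (\<iota> z) = z" if "z \<in> points S" for z using j that by (simp add: homeomorphic_maps_def)
  define f where "f = j \<circ> (\<phi> g \<circ> \<iota>)"
  have top: "topspace (subtopology (man_top S) K) = K" using Ks by auto
  have \<iota>f: "\<iota> (f x) = \<phi> g (\<iota> x)" and f': "f x \<in> K'" if "x \<in> K" for x
  proof -
    have "\<phi> g (\<iota> x) \<in> \<iota> ` K'" using that by (simp flip: gK)
    then obtain y where y: "y \<in> K'" "\<phi> g (\<iota> x) = \<iota> y" by auto
    then have "f x = y" using ji K' by (auto simp: f_def)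
    then show "\<iota> (f x) = \<phi> g (\<iota> x)" "f x \<in> K'" using y by auto
  qed
  have inj: "inj_on f K"
  proof (rule inj_onI)
    fix x y assume xy: "x \<in> K" "y \<in> K" "f x = f y"
    then have "\<phi> g (\<iota> x) = \<phi> g (\<iota> y)" using \<iota>f by metis
    then have "\<iota> x = \<iota> y" using act_inv[OF g] iota_in xy Ks by (metis subsetD)
    then show "x = y" using inj_iota xy Ks by (meson inj_onD subsetD)
  qed
  have "continuous_map (subtopology (man_top S) K) (man_top M) (\<phi> g \<circ> \<iota>)"
    by (intro continuous_map_compose[of _ "man_top M"] continuous_map_from_subtopology cont_iota cont g)
  \<comment> \<open>The inverse \<open>j\<close> is known to be continuous on the image of \<iota>
    only, so the values must be shown to lie there before composing.\<close>
  moreover have "\<phi> g (\<iota> x) \<in> \<iota> ` points S" if "x \<in> K" for x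
    using \<iota>f[OF that] f'[OF that] K' by (metis image_eqI subsetD)
  ultimately have "continuous_map (subtopology (man_top S) K)
      (subtopology (man_top M) (\<iota> ` points S)) (\<phi> g \<circ> \<iota>)"
    using top by (auto simp: continuous_map_in_subtopology)
  then have "continuous_map (subtopology (man_top S) K) (man_top S) f"
    unfolding f_def
    by (rule continuous_map_compose) (use j in \<open>simp add: homeomorphic_maps_def\<close>)
  then have "embedding_map (subtopology (man_top S) K) (man_top S) f"
    using inj top by (intro injective_closed_imp_embedding_map continuous_imp_closed_map)
      (auto simp: K compact_space_subtopology Hausdorff_S)
  moreover have "f ` K = K'"
  proof -
    have "\<iota> ` f ` K = \<iota> ` K'" using \<iota>f gK by (simp add: image_image)
    then show ?thesis using iota_image_eq f' K' by (metis image_subsetI subset_trans)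
  qed
  ultimately show ?thesis using that \<iota>f by blast
qed

text \<open>This is where freeness enters. Over a suitable open segment \<open>D\<close> in the
  overlap, \<open>inv h \<otimes> g\<close> carries one open segment of \<open>K\<close> to another
  as seen through \<iota>. Freeness of \<open>K\<close> then puts this element into
  \<open>H\<close>.\<close>

lemma overlapping_translates:
  assumes K: "K \<in> free_segments G \<phi> M S \<iota>" "compactin (man_top S) K"
    and gh: "g \<in> carrier G" "h \<in> carrier G"
    and K12: "K1 \<subseteq> points S" "K2 \<subseteq> points S"
    and eq: "\<phi> g ` \<iota> ` K = \<iota> ` K1" "\<phi> h ` \<iota> ` K = \<iota> ` K2"
    and C: "C \<in> segments S" "C \<subseteq> K1 \<inter> K2"
  shows "coset_of G \<phi> S \<iota> g = coset_of G \<phi> S \<iota> h" "K1 = K2"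
proof -
  interpret G: group G by (rule group_G)
  have Ks: "K \<subseteq> points S" using K compactin_subset_topspace by blast
  obtain f where f: "embedding_map (subtopology (man_top S) K) (man_top S) f" "f ` K = K1"
    "\<And>x. x \<in> K \<Longrightarrow> \<iota> (f x) = \<phi> g (\<iota> x)"
    using transport_map[OF gh(1) K(2) K12(1) eq(1)] by blast
  obtain f' where f': "embedding_map (subtopology (man_top S) K) (man_top S) f'" "f' ` K = K2"
    "\<And>x. x \<in> K \<Longrightarrow> \<iota> (f' x) = \<phi> h (\<iota> x)"
    using transport_map[OF gh(2) K(2) K12(2) eq(2)] by blast
  \<comment> \<open>Shrinking happens twice: \<open>C1\<close> is adapted to \<open>f\<close>, and
    \<open>D\<close> inside \<open>C1\<close> to \<open>f'\<close>. As \<open>C1\<close> is good for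
    all its open subsegments, \<open>D\<close> serves both maps.\<close>
  obtain C1 where C1: "C1 \<subseteq> C" "C1 \<in> segments S" "openin (man_top S) C1"
    "\<And>D. \<lbrakk>D \<subseteq> C1; D \<in> segments S; openin (man_top S) D\<rbrakk> \<Longrightarrow>
       {x \<in> K. f x \<in> D} \<in> segments S \<and> openin (man_top S) {x \<in> K. f x \<in> D}"
    by (rule embedding_open_segment[OF circle Ks f(1) C(1)]) (use C f(2) in auto)
  obtain D where D: "D \<subseteq> C1" "D \<in> segments S" "openin (man_top S) D"
    "\<And>E. \<lbrakk>E \<subseteq> D; E \<in> segments S; openin (man_top S) E\<rbrakk> \<Longrightarrow>
       {x \<in> K. f' x \<in> E} \<in> segments S \<and> openin (man_top S) {x \<in> K. f' x \<in> E}"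
    by (rule embedding_open_segment[OF circle Ks f'(1) C1(2)]) (use C C1(1) f'(2) in auto)
  define A B where "A = {x \<in> K. f x \<in> D}" and "B = {x \<in> K. f' x \<in> D}"
  have A: "A \<in> segments S" "openin (man_top S) A" "A \<subseteq> K"
    using C1(4)[OF D(1-3)] by (auto simp: A_def)
  have B: "B \<in> segments S" "openin (man_top S) B" "B \<subseteq> K"
    using D(4)[OF order.refl D(2,3)] by (auto simp: B_def)
  have "D \<subseteq> f ` K" "D \<subseteq> f' ` K" using D(1) C1(1) C(2) f(2) f'(2) by auto
  then have fA: "f ` A = D" and fB: "f' ` B = D" unfolding A_def B_def by blast+
  have "\<phi> g ` \<iota> ` A = \<iota> ` f ` A" using f(3) A by (auto simp: image_image intro!: image_cong)
  moreover have "\<phi> h ` \<iota> ` B = \<iota> ` f' ` B" using f'(3) B by (auto simp: image_image intro!: image_cong)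
  ultimately have gh_eq: "\<phi> g ` \<iota> ` A = \<phi> h ` \<iota> ` B" by (simp add: fA fB)
  have iM: "\<iota> ` A \<subseteq> points M" "\<iota> ` B \<subseteq> points M" using A B Ks iota_in by blast+
  have "\<phi> (inv h \<otimes> g) ` \<iota> ` A = \<phi> (inv h) ` \<phi> g ` \<iota> ` A"
    unfolding image_image[of "\<phi> (inv h)"]
    by (intro image_cong refl composition_rule) (use iM gh in auto)
  also have "\<dots> = \<iota> ` B"
    unfolding gh_eq image_image[of "\<phi> (inv h)" "\<phi> h"]
    using act_inv[OF gh(2)] iM by (force simp: subset_iff image_iff)
  finally have "sim_open \<phi> M S \<iota> (inv h \<otimes> g) K K"
    unfolding sim_open_def using A B Ks
    by (intro exI[of _ A] exI[of _ B]) (auto intro!: embedding_iota_sub)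
  then have "inv h \<otimes> g \<in> H" using K(1) gh by (simp add: free_segments_def)
  then have mem: "g \<in> h <# H"
    using subgroup.lcos_module_rev[OF subgroup_H group_G gh(2,1)] by simp
  then show "coset_of G \<phi> S \<iota> g = coset_of G \<phi> S \<iota> h"
    unfolding coset_of_def using G.l_repr_independence[OF mem gh(2) subgroup_H] by simp
  \<comment> \<open>Equality of cosets extends the agreement from the small overlap to all of
    \<open>K\<close>.\<close>
  have "\<phi> g ` \<iota> ` K = \<phi> h ` \<iota> ` K" by (rule act_coset_iota[OF gh(2) mem Ks])
  then show "K1 = K2" using eq iota_image_eq K12 by simp
qed

lemma lcoset_representative:
  assumes "c \<in> lcosets\<^bsub>G\<^esub> H"
  obtains g where "g \<in> carrier G" "g \<in> c" "c = coset_of G \<phi> S \<iota> g"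
proof -
  interpret G: group G by (rule group_G)
  obtain g where "g \<in> carrier G" "c = g <# H" using assms by (auto simp: LCOSETS_def)
  then show ?thesis using that G.lcos_self[OF _ subgroup_H] by (auto simp: coset_of_def)
qed

section \<open>Comparing two decompositions\<close>

lemma decomposition_segment:
  assumes "sigma_decomposition G \<phi> M S \<iota> \<Sigma> n \<Sigma>s cs" "k \<le> n"
  shows "\<Sigma>s k \<in> segments S" "\<Sigma>s k \<in> free_segments G \<phi> M S \<iota>" "compactin (man_top S) (\<Sigma>s k)"
    "closedin (man_top S) (\<Sigma>s k)" "\<Sigma>s k \<subseteq> points S"
  using assms compactin_imp_closedin[OF Hausdorff_S]
  by (auto simp: sigma_decomposition_def maximal_free_segments_def free_segments_def
      dest: compactin_subset_topspace)

lemma decomposition_translate: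
  assumes "sigma_decomposition G \<phi> M S \<iota> \<Sigma> n \<Sigma>s cs" "k \<le> n" "g \<in> cs k"
  shows "\<phi> g ` \<iota> ` \<Sigma>s 0 = \<iota> ` \<Sigma>s k"
  using assms unfolding sigma_decomposition_def by meson

lemma translate_in_decomposition:
  assumes dec: "sigma_decomposition G \<phi> M S \<iota> \<Sigma> n \<Sigma>s cs"
    and C: "C \<in> segments S" and g: "g \<in> carrier G" and gC: "\<phi> g ` \<iota> ` \<Sigma>s 0 = \<iota> ` C"
  obtains k where "k \<le> n" "coset_of G \<phi> S \<iota> g = cs k" "C = \<Sigma>s k"
proof -
  have Cs: "C \<subseteq> points S" using C by (auto simp: segments_def connectedin_def)
  have "points S = (\<Union>k\<in>{..n}. \<Sigma>s k)" using dec by (simp add: sigma_decomposition_def)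
  \<comment> \<open>The finite closed cover of the circle determines the index: some
    \<open>\<Sigma>s k\<close> shares a segment with \<open>C\<close>.\<close>
  then obtain k A where k: "k \<le> n" "A \<subseteq> C \<inter> \<Sigma>s k" "A \<in> segments S"
    using segment_subset_finite_closed_union[OF circle finite_atMost[of n], of \<Sigma>s C] Cs C
      decomposition_segment(4)[OF dec] by auto
  have "cs k \<in> lcosets\<^bsub>G\<^esub> H" using dec k(1) by (simp add: sigma_decomposition_def)
  then obtain h where h: "h \<in> carrier G" "h \<in> cs k" "cs k = coset_of G \<phi> S \<iota> h"
    by (rule lcoset_representative)
  have "\<phi> h ` \<iota> ` \<Sigma>s 0 = \<iota> ` \<Sigma>s k" by (rule decomposition_translate[OF dec k(1) h(2)])
  from overlapping_translates[OF decomposition_segment(2,3)[OF dec le0] g h(1) Cs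
      decomposition_segment(5)[OF dec k(1)] gC this k(3,2)]
  show ?thesis using that k h by simp
qed

lemma decomposition_intersections:
  assumes dec: "sigma_decomposition G \<phi> M S \<iota> \<Sigma> n \<Sigma>s cs" and n: "2 \<le> n"
    and pq: "p \<le> n" "q \<le> n"
  shows "\<bar>int p - int q\<bar> \<in> {1, int n} \<Longrightarrow> is_singleton (\<Sigma>s p \<inter> \<Sigma>s q)"
    "2 \<le> \<bar>int p - int q\<bar> \<Longrightarrow> \<bar>int p - int q\<bar> \<le> int n - 1 \<Longrightarrow> \<Sigma>s p \<inter> \<Sigma>s q = {}"
proof -
  have *: "\<forall>p\<le>n. \<forall>q\<le>n.
           (\<bar>int p - int q\<bar> \<in> {1, int n} \<longrightarrow>
              \<Sigma>s p \<inter> \<Sigma>s q = seg_boundary S (\<Sigma>s p) \<inter> seg_boundary S (\<Sigma>s q) \<and>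
              is_singleton (\<Sigma>s p \<inter> \<Sigma>s q)) \<and>
           (2 \<le> \<bar>int p - int q\<bar> \<and> \<bar>int p - int q\<bar> \<le> int n - 1 \<longrightarrow> \<Sigma>s p \<inter> \<Sigma>s q = {})"
    using dec n unfolding sigma_decomposition_def by blast
  show "\<bar>int p - int q\<bar> \<in> {1, int n} \<Longrightarrow> is_singleton (\<Sigma>s p \<inter> \<Sigma>s q)"
    using * pq by blast
  show "2 \<le> \<bar>int p - int q\<bar> \<Longrightarrow> \<bar>int p - int q\<bar> \<le> int n - 1 \<Longrightarrow> \<Sigma>s p \<inter> \<Sigma>s q = {}"
    using * pq by blast
qed

text \<open>Members with different indices meet in at most two points, whereas segments are
  infinite.\<close>

lemma inj_on_decomposition:
  assumes dec: "sigma_decomposition G \<phi> M S \<iota> \<Sigma> n \<Sigma>s cs"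
  shows "inj_on \<Sigma>s {..n}"
proof (rule inj_onI, rule ccontr)
  fix p q assume pq: "p \<in> {..n}" "q \<in> {..n}" "\<Sigma>s p = \<Sigma>s q" "p \<noteq> q"
  have inf: "infinite (\<Sigma>s k)" if "k \<le> n" for k
    using decomposition_segment(1)[OF dec that] Hausdorff_S infinite_segment by blast
  have "n = 1 \<or> 2 \<le> n" using dec by (auto simp: sigma_decomposition_def)
  then have "finite (\<Sigma>s p \<inter> \<Sigma>s q)"
  proof
    assume n: "n = 1"
    then have "card (\<Sigma>s 0 \<inter> \<Sigma>s 1) = 2"
      using dec by (auto simp: sigma_decomposition_def)
    then have "finite (\<Sigma>s 0 \<inter> \<Sigma>s 1)" by (intro card_ge_0_finite) simp
    moreover have "p = 0 \<and> q = 1 \<or> p = 1 \<and> q = 0" using pq n by auto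
    ultimately show ?thesis by (auto simp: Int_commute)
  next
    assume "2 \<le> n"
    note inter = decomposition_intersections[OF dec this, of p q]
    \<comment> \<open>The adjacent and the disjoint case together exhaust all pairs of distinct
      indices.\<close>
    have "\<bar>int p - int q\<bar> \<in> {1, int n} \<or> 2 \<le> \<bar>int p - int q\<bar> \<and> \<bar>int p - int q\<bar> \<le> int n - 1"
      using pq by auto
    then show ?thesis using inter pq by (auto simp: is_singleton_def)
  qed
  then show False using inf pq by simp
qed

text \<open>Each member of one decomposition is a translate of \<Sigma>, hence occurs in the other
  with the same coset. By symmetry both have the same set of segments, and injectivity turns this
  into equal length and a permutation.\<close>

lemma decompositions_permuted:
  assumes dec: "sigma_decomposition G \<phi> M S \<iota> \<Sigma> n \<Sigma>s cs"
    and dec': "sigma_decomposition G \<phi> M S \<iota> \<Sigma> n' \<Sigma>s' cs'"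
  obtains \<pi> where "n' = n" "\<pi> \<in> {..n} \<rightarrow> {..n}" "inj_on \<pi> {..n}" "\<pi> 0 = 0"
    "\<And>k. k \<le> n \<Longrightarrow> \<Sigma>s' k = \<Sigma>s (\<pi> k) \<and> cs' k = cs (\<pi> k)"
proof -
  \<comment> \<open>Stated for an arbitrary pair of decompositions, since it is applied in both
    directions.\<close>
  have ex: "\<exists>j\<le>m. Ts k = Us j \<and> bs k = ds j"
    if dec1: "sigma_decomposition G \<phi> M S \<iota> \<Sigma> l Ts bs"
      and dec2: "sigma_decomposition G \<phi> M S \<iota> \<Sigma> m Us ds" and "k \<le> l" for l Ts bs m Us ds k
  proof -
    have "bs k \<in> lcosets\<^bsub>G\<^esub> H" using dec1 \<open>k \<le> l\<close> by (simp add: sigma_decomposition_def)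
    then obtain g where g: "g \<in> carrier G" "g \<in> bs k" "bs k = coset_of G \<phi> S \<iota> g"
      by (rule lcoset_representative)
    have "Us 0 = Ts 0" using dec1 dec2 by (simp add: sigma_decomposition_def)
    then have "\<phi> g ` \<iota> ` Us 0 = \<iota> ` Ts k"
      using decomposition_translate[OF dec1 \<open>k \<le> l\<close> g(2)] by simp
    from translate_in_decomposition[OF dec2 decomposition_segment(1)[OF dec1 \<open>k \<le> l\<close>] g(1) this]
    obtain j where "j \<le> m" "coset_of G \<phi> S \<iota> g = ds j" "Ts k = Us j" .
    then show ?thesis using g by auto
  qed
  have "\<forall>k. \<exists>j. k \<le> n' \<longrightarrow> j \<le> n \<and> \<Sigma>s' k = \<Sigma>s j \<and> cs' k = cs j" using ex[OF dec' dec] by blast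
  then obtain \<pi> where \<pi>: "\<And>k. k \<le> n' \<Longrightarrow> \<pi> k \<le> n \<and> \<Sigma>s' k = \<Sigma>s (\<pi> k) \<and> cs' k = cs (\<pi> k)"
    by metis
  have inj: "inj_on \<pi> {..n'}"
    using inj_on_decomposition[OF dec'] \<pi> by (metis atMost_iff inj_onD inj_onI)
  have "\<Sigma>s ` {..n} = \<Sigma>s' ` {..n'}"
    using ex[OF dec dec'] ex[OF dec' dec] by (fastforce simp: image_iff)
  then have "card {..n} = card {..n'}"
    using card_image[OF inj_on_decomposition[OF dec]] card_image[OF inj_on_decomposition[OF dec']] by simp
  then have n: "n' = n" by simp
  have "\<Sigma>s (\<pi> 0) = \<Sigma>s 0" using \<pi>[of 0] dec dec' by (simp add: sigma_decomposition_def)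
  then have "\<pi> 0 = 0" using inj_onD[OF inj_on_decomposition[OF dec]] \<pi>[of 0] by auto
  then show ?thesis using that[of \<pi>] n \<pi> inj by auto
qed

end

section \<open>Symmetries of a cycle with a fixed vertex\<close>

text \<open>The neighbours of 0 are 1 and \<open>n\<close>, so \<open>\<pi> 1\<close> is one of
  them. Afterwards each value is forced: it is the neighbour of the preceding value that has not
  been used one step earlier.\<close>

lemma cycle_automorphism_fixing_0:
  assumes n: "2 \<le> n" and maps: "\<pi> \<in> {..n} \<rightarrow> {..n}" and inj: "inj_on \<pi> {..n}" and 0: "\<pi> 0 = 0"
    and adj: "\<And>p q. \<lbrakk>p \<le> n; q \<le> n; \<bar>int p - int q\<bar> \<in> {1, int n}\<rbrakk> \<Longrightarrow>
      \<bar>int (\<pi> p) - int (\<pi> q)\<bar> \<in> {1, int n}"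
  shows "(\<forall>k\<le>n. \<pi> k = k) \<or> (\<forall>k\<le>n. \<pi> k = (if k = 0 then 0 else zeta n k))"
proof -
  have ne: "\<pi> i \<noteq> \<pi> j" if "i \<le> n" "j \<le> n" "i \<noteq> j" for i j using inj_onD[OF inj] that by auto
  have le: "\<pi> i \<le> n" if "i \<le> n" for i using maps that by auto
  have step: "\<bar>int (\<pi> k) - int (\<pi> (Suc k))\<bar> \<in> {1, int n}" if "Suc k \<le> n" for k
    using adj[of k "Suc k"] that by simp
  have "\<pi> 1 = 1 \<or> \<pi> 1 = n" using step[of 0] n 0 by auto
  then show ?thesis
  proof
    assume 1: "\<pi> 1 = 1"
    have "\<pi> k = k" if "k \<le> n" for k
      using that
    proof (induction k rule: less_induct)
      case (less k)
      consider "k = 0" | "k = 1" | j where "k = Suc (Suc j)" by (cases k rule: nat.exhaust; metis One_nat_def not0_implies_Suc)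
      then show ?case
      proof cases
        case 3
        have "\<pi> (Suc j) = Suc j" "\<pi> j = j" using less 3 by auto
        \<comment> \<open>Since \<open>Suc j\<close> lies strictly between 0 and \<open>n\<close>,
          distance \<open>n\<close> from it is impossible. Its neighbours are \<open>j\<close>,
          already taken, and \<open>k\<close>.\<close>
        moreover have "\<pi> k \<noteq> \<pi> j" "\<pi> k \<le> n" using ne[of k j] le less.prems 3 by auto
        ultimately show ?thesis using step[of "Suc j"] less.prems 3 by auto
      qed (use 0 1 in auto)
    qed
    then show ?thesis by blast
  next
    assume 1: "\<pi> 1 = n"
    have "\<pi> k = (if k = 0 then 0 else zeta n k)" if "k \<le> n" for k
      using that
    proof (induction k rule: less_induct)
      case (less k)
      \<comment> \<open>The case \<open>k = 2\<close> stands apart because it looks back to index 0,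
        where the reflection is not given by \<open>zeta\<close>: truncated subtraction makes
        \<open>zeta n 0\<close> equal to \<open>n\<close>.\<close>
      consider "k = 0" | "k = 1" | "k = 2" | j where "k = Suc (Suc (Suc j))"
        by (metis One_nat_def Suc_1 not0_implies_Suc)
      then show ?case
      proof cases
        case 3
        have "\<pi> k \<noteq> \<pi> 0" "\<pi> k \<le> n" using ne[of k 0] le less.prems 3 by auto
        then show ?thesis using step[of 1] 1 0 less.prems 3 by (auto simp: zeta_def numeral_2_eq_2)
      next
        case 4
        have "\<pi> (Suc (Suc j)) = n - Suc j" "\<pi> (Suc j) = n - j"
          using less.IH[of "Suc (Suc j)"] less.IH[of "Suc j"] less.prems 4 by (auto simp: zeta_def)
        moreover have "\<pi> k \<noteq> \<pi> (Suc j)" "\<pi> k \<le> n" "\<pi> k \<noteq> \<pi> 0"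
          using ne[of k "Suc j"] ne[of k 0] le less.prems 4 by auto
        ultimately show ?thesis using step[of "Suc (Suc j)"] less.prems 4 by (auto simp: zeta_def)
      qed (use 0 1 in \<open>auto simp: zeta_def\<close>)
    qed
    then show ?thesis by blast
  qed
qed

text \<open>Moves the case distinction into the index, so that reversal becomes composition with an
  index map.\<close>

lemma reversed_conv: "reversed n f k = f (if k = 0 then 0 else zeta n k)"
  by (simp add: reversed_def)

section \<open>Reversal and uniqueness of decompositions\<close>

context action_on_circle
begin

text \<open>The index map \<open>z\<close> is an involution of the cycle that respects adjacency, so
  every clause of the definition is carried over by reindexing.\<close>

lemma reversed_decomposition:
  assumes n: "2 \<le> n" and dec: "sigma_decomposition G \<phi> M S \<iota> \<Sigma> n \<Sigma>s cs"
  shows "sigma_decomposition G \<phi> M S \<iota> \<Sigma> n (reversed n \<Sigma>s) (reversed n cs)"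
proof -
  define z where "z k = (if k = 0 then 0 else zeta n k)" for k
  have rev: "reversed n \<Sigma>s = (\<lambda>k. \<Sigma>s (z k))" "reversed n cs = (\<lambda>k. cs (z k))"
    by (auto simp: reversed_conv z_def)
  have z: "z k \<le> n" "z (z k) = k" if "k \<le> n" for k
    using that by (auto simp: z_def zeta_def)
  have im: "z ` {..n} = {..n}" using z by (force simp: image_iff)
  \<comment> \<open>For positive indices \<open>z k\<close> is \<open>n + 1 - k\<close>, which
    preserves distances. When exactly one index is 0, the distance \<open>d\<close> becomes
    \<open>n + 1 - d\<close>, which exchanges 1 with \<open>n\<close> and maps the range from 2 to
    \<open>n - 1\<close> to itself.\<close>
  have dist: "\<bar>int (z p) - int (z q)\<bar> = \<bar>int p - int q\<bar> \<or>
      \<bar>int (z p) - int (z q)\<bar> = int n + 1 - \<bar>int p - int q\<bar> \<and> p \<noteq> q" if "p \<le> n" "q \<le> n" for p q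
    using that by (auto simp: z_def zeta_def)
  have adj: "\<bar>int (z p) - int (z q)\<bar> \<in> {1, int n}"
    if "p \<le> n" "q \<le> n" "\<bar>int p - int q\<bar> \<in> {1, int n}" for p q
    using dist[OF that(1,2)] that(3) n by auto
  have nonadj: "2 \<le> \<bar>int (z p) - int (z q)\<bar> \<and> \<bar>int (z p) - int (z q)\<bar> \<le> int n - 1"
    if "p \<le> n" "q \<le> n" "2 \<le> \<bar>int p - int q\<bar> \<and> \<bar>int p - int q\<bar> \<le> int n - 1" for p q
    using dist[OF that(1,2)] that(3) n by auto
  have "(\<Union>k\<le>n. \<Sigma>s (z k)) = (\<Union>k\<in>z ` {..n}. \<Sigma>s k)" by simp
  then have union: "(\<Union>k\<le>n. \<Sigma>s (z k)) = (\<Union>k\<le>n. \<Sigma>s k)" by (simp only: im)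
  have z0: "z 0 = 0" by (simp add: z_def)
  have *: "\<forall>p\<le>n. \<forall>q\<le>n.
           (\<bar>int p - int q\<bar> \<in> {1, int n} \<longrightarrow>
              \<Sigma>s p \<inter> \<Sigma>s q = seg_boundary S (\<Sigma>s p) \<inter> seg_boundary S (\<Sigma>s q) \<and>
              is_singleton (\<Sigma>s p \<inter> \<Sigma>s q)) \<and>
           (2 \<le> \<bar>int p - int q\<bar> \<and> \<bar>int p - int q\<bar> \<le> int n - 1 \<longrightarrow> \<Sigma>s p \<inter> \<Sigma>s q = {})"
    using dec n unfolding sigma_decomposition_def by blast
  have "\<forall>p\<le>n. \<forall>q\<le>n.
           (\<bar>int p - int q\<bar> \<in> {1, int n} \<longrightarrow>
              \<Sigma>s (z p) \<inter> \<Sigma>s (z q) = seg_boundary S (\<Sigma>s (z p)) \<inter> seg_boundary S (\<Sigma>s (z q)) \<and>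
              is_singleton (\<Sigma>s (z p) \<inter> \<Sigma>s (z q))) \<and>
           (2 \<le> \<bar>int p - int q\<bar> \<and> \<bar>int p - int q\<bar> \<le> int n - 1 \<longrightarrow> \<Sigma>s (z p) \<inter> \<Sigma>s (z q) = {})"
    using * adj nonadj z(1) by meson
  moreover have "1 \<le> n"
     "\<forall>k\<le>n. \<Sigma>s (z k) \<in> maximal_free_segments G \<phi> M S \<iota> \<and> compactin (man_top S) (\<Sigma>s (z k))"
     "\<forall>k\<le>n. cs (z k) \<in> lcosets\<^bsub>G\<^esub> H" "\<Sigma>s (z 0) = \<Sigma>" "points S = (\<Union>k\<le>n. \<Sigma>s (z k))"
    using dec z(1) by (simp_all add: union z0 sigma_decomposition_def)
  moreover have "\<forall>k\<le>n. \<forall>g\<in>cs (z k). \<phi> g ` \<iota> ` \<Sigma>s (z 0) = \<iota> ` \<Sigma>s (z k)"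
    using decomposition_translate[OF dec z(1)] by (simp add: z0)
  ultimately show ?thesis
    unfolding sigma_decomposition_def rev using n
    by (intro conjI impI) (assumption | linarith)+
qed

text \<open>A permutation of two indices that fixes 0 is the identity.\<close>

lemma decomposition_unique_1:
  assumes dec: "sigma_decomposition G \<phi> M S \<iota> \<Sigma> 1 \<Sigma>s cs"
    and dec': "sigma_decomposition G \<phi> M S \<iota> \<Sigma> n' \<Sigma>s' cs'"
  shows "same_family 1 \<Sigma>s cs n' \<Sigma>s' cs'"
proof -
  obtain \<pi> where n': "n' = 1" and \<pi>: "\<pi> \<in> {..1} \<rightarrow> {..1::nat}" "inj_on \<pi> {..1}" "\<pi> 0 = 0"
    "\<And>k. k \<le> 1 \<Longrightarrow> \<Sigma>s' k = \<Sigma>s (\<pi> k) \<and> cs' k = cs (\<pi> k)"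
    using decompositions_permuted[OF dec dec'] by blast
  have "\<pi> 1 \<noteq> \<pi> 0" "\<pi> 1 \<le> 1" using inj_onD[OF \<pi>(2), of 1 0] \<pi>(1) by auto
  then have "\<pi> k = k" if "k \<le> 1" for k
    using \<pi>(3) that by (cases "k = 0") (auto simp: le_Suc_eq)
  then show ?thesis using n' \<pi>(4) by (simp add: same_family_def)
qed

text \<open>The permutation relating the two families respects adjacency: otherwise two segments
  would share a point in one decomposition and be disjoint in the other. It is thus the identity or
  the reflection.\<close>

lemma decomposition_unique_up_to_reversal:
  assumes n: "2 \<le> n"
    and dec: "sigma_decomposition G \<phi> M S \<iota> \<Sigma> n \<Sigma>s cs"
    and dec': "sigma_decomposition G \<phi> M S \<iota> \<Sigma> n' \<Sigma>s' cs'"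
  shows "same_family n \<Sigma>s cs n' \<Sigma>s' cs' \<or>
    same_family n (reversed n \<Sigma>s) (reversed n cs) n' \<Sigma>s' cs'"
proof -
  obtain \<pi> where n': "n' = n" and maps: "\<pi> \<in> {..n} \<rightarrow> {..n}" and inj: "inj_on \<pi> {..n}"
    and 0: "\<pi> 0 = 0" and \<pi>: "\<And>k. k \<le> n \<Longrightarrow> \<Sigma>s' k = \<Sigma>s (\<pi> k) \<and> cs' k = cs (\<pi> k)"
    using decompositions_permuted[OF dec dec'] by blast
  have "\<bar>int (\<pi> p) - int (\<pi> q)\<bar> \<in> {1, int n}"
    if pq: "p \<le> n" "q \<le> n" "\<bar>int p - int q\<bar> \<in> {1, int n}" for p q
  proof (rule ccontr)
    assume nadj: "\<bar>int (\<pi> p) - int (\<pi> q)\<bar> \<notin> {1, int n}"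
    have le: "\<pi> p \<le> n" "\<pi> q \<le> n" using maps pq by auto
    have "p \<noteq> q" using pq n by auto
    then have "\<pi> p \<noteq> \<pi> q" using inj_onD[OF inj] pq by auto
    then have "2 \<le> \<bar>int (\<pi> p) - int (\<pi> q)\<bar>" "\<bar>int (\<pi> p) - int (\<pi> q)\<bar> \<le> int n - 1"
      using nadj le by auto
    then have "\<Sigma>s (\<pi> p) \<inter> \<Sigma>s (\<pi> q) = {}"
      by (rule decomposition_intersections(2)[OF dec n le])
    moreover have "is_singleton (\<Sigma>s' p \<inter> \<Sigma>s' q)"
      using decomposition_intersections(1)[OF dec'[unfolded n'] n] pq by blast
    ultimately show False using \<pi> pq by (simp add: is_singleton_def)
  qed
  from cycle_automorphism_fixing_0[OF n maps inj 0 this] show ?thesis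
    using \<pi> n' by (auto simp: same_family_def reversed_conv)
qed

text \<open>Reversal exchanges the indices 1 and \<open>n\<close>, which are distinct and carry
  distinct segments.\<close>

lemma reversed_decomposition_differs:
  assumes n: "2 \<le> n" and dec: "sigma_decomposition G \<phi> M S \<iota> \<Sigma> n \<Sigma>s cs"
  shows "\<not> same_family n \<Sigma>s cs n (reversed n \<Sigma>s) (reversed n cs)"
proof
  assume "same_family n \<Sigma>s cs n (reversed n \<Sigma>s) (reversed n cs)"
  then have "\<Sigma>s n = \<Sigma>s 1"
    using n by (auto simp: same_family_def reversed_conv zeta_def dest!: spec[of _ 1])
  then show False using inj_onD[OF inj_on_decomposition[OF dec], of n 1] n by auto
qed

end

theorem lemma21:
  fixes G :: "('g, 'r) monoid_scheme" and L :: "'g manifold"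
    and M :: "'m manifold" and \<phi> :: "'g \<Rightarrow> 'm \<Rightarrow> 'm"
    and S :: "'s manifold" and \<iota> :: "'s \<Rightarrow> 'm"
    and \<Sigma> :: "'s set" and n :: nat and \<Sigma>s :: "nat \<Rightarrow> 's set" and gs :: "nat \<Rightarrow> 'g"
  assumes "lie_group G L"
    and "analytic_manifold M"
    and "pointwise_continuous_action G L M \<phi>"
    and "non_contractive G M \<phi>"
    and "analytic_1_submanifold M S \<iota>"
    and "free_submanifold G \<phi> M S \<iota>"
    and "homeomorphic_U1 S"
    and "points S \<notin> free_segments G \<phi> M S \<iota>"
    and "\<Sigma> \<in> maximal_free_segments G \<phi> M S \<iota>"
    and "\<Sigma> \<subset> points S"
    and "\<forall>k\<le>n. gs k \<in> carrier G"
    and "sigma_decomposition G \<phi> M S \<iota> \<Sigma> n \<Sigma>s (\<lambda>k. coset_of G \<phi> S \<iota> (gs k))"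
  shows "(\<forall>\<Sigma>'\<in>segments S. \<forall>g\<in>carrier G. \<phi> g ` \<iota> ` \<Sigma>s 0 = \<iota> ` \<Sigma>' \<longrightarrow>
            (\<exists>!k. k \<le> n \<and> coset_of G \<phi> S \<iota> g = coset_of G \<phi> S \<iota> (gs k) \<and> \<Sigma>' = \<Sigma>s k))
       \<and> (n = 1 \<longrightarrow>
            (\<forall>n' \<Sigma>s' cs'. sigma_decomposition G \<phi> M S \<iota> \<Sigma> n' \<Sigma>s' cs' \<longrightarrow>
               same_family n \<Sigma>s (\<lambda>k. coset_of G \<phi> S \<iota> (gs k)) n' \<Sigma>s' cs'))
       \<and> (2 \<le> n \<longrightarrow>
            sigma_decomposition G \<phi> M S \<iota> \<Sigma> n
              (reversed n \<Sigma>s) (reversed n (\<lambda>k. coset_of G \<phi> S \<iota> (gs k))) \<and>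
            \<not> same_family n \<Sigma>s (\<lambda>k. coset_of G \<phi> S \<iota> (gs k))
                n (reversed n \<Sigma>s) (reversed n (\<lambda>k. coset_of G \<phi> S \<iota> (gs k))) \<and>
            (\<forall>n' \<Sigma>s' cs'. sigma_decomposition G \<phi> M S \<iota> \<Sigma> n' \<Sigma>s' cs' \<longrightarrow>
               same_family n \<Sigma>s (\<lambda>k. coset_of G \<phi> S \<iota> (gs k)) n' \<Sigma>s' cs' \<or>
               same_family n (reversed n \<Sigma>s) (reversed n (\<lambda>k. coset_of G \<phi> S \<iota> (gs k)))
                 n' \<Sigma>s' cs'))"
proof -
  interpret group_action G "points M" \<phi>
    using assms(3) by (simp add: pointwise_continuous_action_def)
  interpret action_on_circle G M \<phi> S \<iota>
    using assms(2,4,5,7)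
    by unfold_locales
       (auto simp: non_contractive_def action_analytic_in_def analytic_map_def
         analytic_manifold_gen_def analytic_1_submanifold_def)
  note dec = assms(12)
  have "\<exists>!k. k \<le> n \<and> coset_of G \<phi> S \<iota> g = coset_of G \<phi> S \<iota> (gs k) \<and> \<Sigma>' = \<Sigma>s k"
    if \<Sigma>': "\<Sigma>' \<in> segments S" "g \<in> carrier G" "\<phi> g ` \<iota> ` \<Sigma>s 0 = \<iota> ` \<Sigma>'" for \<Sigma>' g
  proof (rule ex_ex1I)
    show "\<exists>k. k \<le> n \<and> coset_of G \<phi> S \<iota> g = coset_of G \<phi> S \<iota> (gs k) \<and> \<Sigma>' = \<Sigma>s k"
      using translate_in_decomposition[OF dec \<Sigma>'] by metis
  \<comment> \<open>Uniqueness of the index follows from the segments alone, as they are pairwise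
    distinct.\<close>
  qed (use inj_on_decomposition[OF dec] in \<open>auto dest: inj_onD\<close>)
  moreover have "same_family n \<Sigma>s (\<lambda>k. coset_of G \<phi> S \<iota> (gs k)) n' \<Sigma>s' cs'"
    if "n = 1" "sigma_decomposition G \<phi> M S \<iota> \<Sigma> n' \<Sigma>s' cs'" for n' \<Sigma>s' cs'
    using decomposition_unique_1 dec that by simp
  ultimately show ?thesis
    using reversed_decomposition[OF _ dec] reversed_decomposition_differs[OF _ dec]
      decomposition_unique_up_to_reversal[OF _ dec]
    by (intro conjI ballI allI impI)
qed

end
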